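(* Let $\mathbb{K}$ be a field of characteristic zero and $R$ a unital commutative associative $\mathbb{K}$-algebra. For the $R$-module $\Omega^1_R$ and $X,Y\in T_R$, define the anchor map $$\rho\colon\Omega^1_R\to T_R,\quad\rho(\alpha):=\langle\alpha,Y\rangle X.$$ If the $R$-bilinear mapping $$\Omega^1_R\times\Omega^1_R\to R,\quad(\alpha_1,\alpha_2)\mapsto\langle\alpha_1,Y\rangle\langle\alpha_2,[X,Y]\rangle$$ is symmetric, then the mapping $$\Omega^1_R\times\Omega^1_R\to\Omega^1_R,\quad(\alpha_1,\alpha_2)\mapsto\alpha_1\cdot\alpha_2:=\nabla_{\alpha_1}\alpha_2:=\langle\alpha_1,Y\rangle\pounds_X\alpha_2$$ defines the structure of a pre-Lie-Rinehart algebra on $\Omega^1_R$ (with anchor $\rho$), with its corresponding Lie-Rinehart bracket $$\Omega^1_R\times\Omega^1_R\to\Omega^1_R,\quad[\alpha_1,\alpha_2]:=\langle\alpha_1,Y\rangle\pounds_X\alpha_2-\langle\alpha_2,Y\rangle\pounds_X\alpha_1.$$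
   Context: $T_R:=\mathrm{Der}(R)$ is the $R$-module and Lie algebra (under commutators) of all $\mathbb{K}$-linear derivations $R\to R$; $\Omega^1_R:=\mathrm{Hom}_R(T_R,R)$; $\langle\alpha,X\rangle:=\alpha(X)$ for $\alpha\in\Omega^1_R$, $X\in T_R$. For $X\in T_R$ the Lie derivative $\pounds_X\colon\Omega^1_R\to\Omega^1_R$ is $(\pounds_X\alpha)(Z):=X(\alpha(Z))-\alpha([X,Z])$ for $Z\in T_R$. For an $R$-module $L$, $$\mathcal{CDO}(L):=\{(D,X)\in\mathrm{End}_{\mathbb{K}}(L)\times\mathrm{Der}(R)\mid D(r\ell)=rD(\ell)+X(r)\ell\text{ for all }r\in R,\ \ell\in L\},$$ an $R$-module via $r\cdot(D,X)=(rD,rX)$. Let $L$ be a unital left $R$-module with an $R$-linear map (anchor) $\rho^L\colon L\to T_R$. A pre-Lie-Rinehart algebra structure on $L$ is an $R$-linear map $\nabla\colon L\to\mathcal{CDO}(L)$ of the form $\nabla(\ell)=(\nabla_\ell,\rho^L(\ell))$ such that, with $\ell_1\cdot\ell_2:=\nabla_{\ell_1}\ell_2$ and $[\ell_1,\ell_2]:=\ell_1\cdot\ell_2-\ell_2\cdot\ell_1$: (a) the associator $(\ell_1,\ell_2,\ell_3):=\ell_1\cdot(\ell_2\cdot\ell_3)-(\ell_1\cdot\ell_2)\cdot\ell_3$ satisfies $(\ell_1,\ell_2,\ell_3)=(\ell_2,\ell_1,\ell_3)$ for all $\ell_1,\ell_2,\ell_3\in L$; (b) $\rho^L([\ell_1,\ell_2])=[\rho^L(\ell_1),\rho^L(\ell_2)]$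 for all $\ell_1,\ell_2\in L$. The bracket $[\cdot,\cdot]$ is the corresponding Lie-Rinehart bracket; it turns $L$ into a Lie-Rinehart algebra, i.e. it is a Lie bracket over $\mathbb{K}$ for which $\rho^L$ is a Lie algebra homomorphism and $[\ell_1,r\cdot\ell_2]=r\cdot[\ell_1,\ell_2]+(\rho^L(\ell_1)r)\cdot\ell_2$ for all $r\in R$, $\ell_1,\ell_2\in L$. *)

theory Defs
  imports "HOL-Algebra.Module"
begin

text \<open>
  Functions between carriers are kept extensional (\<open>\<rightarrow>\<^sub>E\<close>), so that equality of maps in
  \<open>Hom\<close>, \<open>Der\<close> and \<open>End\<close> is equality on the carrier. The record type of modules extends that of
  rings; where only a module is meant, the unused fields \<open>mult\<close> and \<open>one\<close> are \<open>undefined\<close>.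
\<close>

section \<open>Modules of maps\<close>

definition linear_maps ::
    "('a, 'x) ring_scheme \<Rightarrow> ('a, 'b, 'y) module_scheme \<Rightarrow> ('a, 'c, 'z) module_scheme \<Rightarrow> ('b \<Rightarrow> 'c) set"
  where
  "linear_maps R M N = {f \<in> carrier M \<rightarrow>\<^sub>E carrier N.
     (\<forall>x\<in>carrier M. \<forall>y\<in>carrier M. f (x \<oplus>\<^bsub>M\<^esub> y) = f x \<oplus>\<^bsub>N\<^esub> f y) \<and>
     (\<forall>r\<in>carrier R. \<forall>x\<in>carrier M. f (r \<odot>\<^bsub>M\<^esub> x) = r \<odot>\<^bsub>N\<^esub> f x)}"

text \<open>The set \<open>H\<close> of maps \<open>S \<rightarrow> carrier N\<close> with the pointwise operations.\<close>

definition pointwise_module ::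
    "'p set \<Rightarrow> ('p \<Rightarrow> 'b) set \<Rightarrow> ('a, 'b, 'y) module_scheme \<Rightarrow> ('a, 'p \<Rightarrow> 'b) module"
  where
  "pointwise_module S H N =
     \<lparr>carrier = H, mult = undefined, one = undefined,
      zero = (\<lambda>p\<in>S. \<zero>\<^bsub>N\<^esub>),
      add = (\<lambda>f g. \<lambda>p\<in>S. f p \<oplus>\<^bsub>N\<^esub> g p),
      smult = (\<lambda>r f. \<lambda>p\<in>S. r \<odot>\<^bsub>N\<^esub> f p)\<rparr>"

definition self_module :: "('a, 'x) ring_scheme \<Rightarrow> ('a, 'a) module" where
  "self_module R =
     \<lparr>carrier = carrier R, mult = mult R, one = one R, zero = zero R, add = add R,
      smult = mult R\<rparr>"

definition hom_module ::
    "('a, 'x) ring_scheme \<Rightarrow> ('a, 'b, 'y) module_scheme \<Rightarrow> ('a, 'c, 'z) module_scheme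
      \<Rightarrow> ('a, 'b \<Rightarrow> 'c) module"
  where
  "hom_module R M N = pointwise_module (carrier M) (linear_maps R M N) N"

text \<open>An \<open>R\<close>-module \<open>L\<close> over a \<open>K\<close>-algebra \<open>R\<close>, viewed as a \<open>K\<close>-module along \<open>c \<mapsto> c \<cdot> 1\<close>.\<close>

definition restrict_scalars ::
    "('k, 'r, 'x) module_scheme \<Rightarrow> ('r, 'l, 'y) module_scheme \<Rightarrow> ('k, 'l) module"
  where
  "restrict_scalars R L =
     \<lparr>carrier = carrier L, mult = undefined, one = undefined, zero = zero L, add = add L,
      smult = (\<lambda>c l. (c \<odot>\<^bsub>R\<^esub> \<one>\<^bsub>R\<^esub>) \<odot>\<^bsub>L\<^esub> l)\<rparr>"


section \<open>Derivations, one-forms and the Lie derivative\<close>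

definition Der :: "('k, 'x) ring_scheme \<Rightarrow> ('k, 'r, 'y) module_scheme \<Rightarrow> ('r \<Rightarrow> 'r) set" where
  "Der K R = {X \<in> linear_maps K R R.
     \<forall>a\<in>carrier R. \<forall>b\<in>carrier R. X (a \<otimes>\<^bsub>R\<^esub> b) = X a \<otimes>\<^bsub>R\<^esub> b \<oplus>\<^bsub>R\<^esub> a \<otimes>\<^bsub>R\<^esub> X b}"

definition der_module ::
    "('k, 'x) ring_scheme \<Rightarrow> ('k, 'r, 'y) module_scheme \<Rightarrow> ('r, 'r \<Rightarrow> 'r) module"
  where
  "der_module K R = pointwise_module (carrier R) (Der K R) (self_module R)"

definition der_bracket ::
    "('k, 'r, 'y) module_scheme \<Rightarrow> ('r \<Rightarrow> 'r) \<Rightarrow> ('r \<Rightarrow> 'r) \<Rightarrow> 'r \<Rightarrow> 'r"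
  where
  "der_bracket R X Y = (\<lambda>r\<in>carrier R. X (Y r) \<ominus>\<^bsub>R\<^esub> Y (X r))"

definition one_forms ::
    "('k, 'x) ring_scheme \<Rightarrow> ('k, 'r, 'y) module_scheme \<Rightarrow> ('r, ('r \<Rightarrow> 'r) \<Rightarrow> 'r) module"
  where
  "one_forms K R = hom_module R (der_module K R) (self_module R)"

definition pairing :: "(('r \<Rightarrow> 'r) \<Rightarrow> 'r) \<Rightarrow> ('r \<Rightarrow> 'r) \<Rightarrow> 'r" (\<open>\<langle>_,/ _\<rangle>\<close>) where
  "\<langle>\<alpha>, X\<rangle> = \<alpha> X"

definition lie_derivative ::
    "('k, 'x) ring_scheme \<Rightarrow> ('k, 'r, 'y) module_scheme \<Rightarrow> ('r \<Rightarrow> 'r)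
      \<Rightarrow> (('r \<Rightarrow> 'r) \<Rightarrow> 'r) \<Rightarrow> (('r \<Rightarrow> 'r) \<Rightarrow> 'r)"
  where
  "lie_derivative K R X \<alpha> = (\<lambda>Z\<in>Der K R. X (\<alpha> Z) \<ominus>\<^bsub>R\<^esub> \<alpha> (der_bracket R X Z))"


section \<open>Lie-Rinehart and pre-Lie-Rinehart algebras\<close>

definition CDO ::
    "('k, 'x) ring_scheme \<Rightarrow> ('k, 'r, 'y) module_scheme \<Rightarrow> ('r, 'l, 'z) module_scheme
      \<Rightarrow> ('r, ('l \<Rightarrow> 'l) \<times> ('r \<Rightarrow> 'r)) module"
  where
  "CDO K R L =
    (let EndK = linear_maps K (restrict_scalars R L) (restrict_scalars R L);
         E = pointwise_module (carrier L) EndK L;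
         T = der_module K R
     in \<lparr>carrier = {(D, X). D \<in> EndK \<and> X \<in> Der K R \<and>
            (\<forall>r\<in>carrier R. \<forall>l\<in>carrier L. D (r \<odot>\<^bsub>L\<^esub> l) = r \<odot>\<^bsub>L\<^esub> D l \<oplus>\<^bsub>L\<^esub> X r \<odot>\<^bsub>L\<^esub> l)},
         mult = undefined, one = undefined,
         zero = (\<zero>\<^bsub>E\<^esub>, \<zero>\<^bsub>T\<^esub>),
         add = (\<lambda>(D, X) (D', X'). (D \<oplus>\<^bsub>E\<^esub> D', X \<oplus>\<^bsub>T\<^esub> X')),
         smult = (\<lambda>r (D, X). (r \<odot>\<^bsub>E\<^esub> D, r \<odot>\<^bsub>T\<^esub> X))\<rparr>)"

locale lie_algebra = module K V for K V +
  fixes bracket :: "'v \<Rightarrow> 'v \<Rightarrow> 'v"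
  assumes linear_right:
      "x \<in> carrier V \<Longrightarrow> (\<lambda>y\<in>carrier V. bracket x y) \<in> linear_maps K V V"
    and linear_left:
      "y \<in> carrier V \<Longrightarrow> (\<lambda>x\<in>carrier V. bracket x y) \<in> linear_maps K V V"
    and alternating: "x \<in> carrier V \<Longrightarrow> bracket x x = \<zero>\<^bsub>V\<^esub>"
    and jacobi:
      "\<lbrakk>x \<in> carrier V; y \<in> carrier V; z \<in> carrier V\<rbrakk> \<Longrightarrow>
        bracket x (bracket y z) \<oplus>\<^bsub>V\<^esub> bracket y (bracket z x) \<oplus>\<^bsub>V\<^esub> bracket z (bracket x y) = \<zero>\<^bsub>V\<^esub>"

locale lie_rinehart_algebra =
    base: algebra K R + L: module R L + lie: lie_algebra K "restrict_scalars R L" bracket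
  for K :: "('k, 'x) ring_scheme" and R :: "('k, 'r, 'y) module_scheme"
    and L :: "('r, 'l, 'z) module_scheme" and bracket :: "'l \<Rightarrow> 'l \<Rightarrow> 'l" +
  fixes anchor :: "'l \<Rightarrow> 'r \<Rightarrow> 'r"
  assumes anchor_linear: "anchor \<in> linear_maps R L (der_module K R)"
    and anchor_bracket:
      "\<lbrakk>l1 \<in> carrier L; l2 \<in> carrier L\<rbrakk> \<Longrightarrow>
        anchor (bracket l1 l2) = der_bracket R (anchor l1) (anchor l2)"
    and leibniz:
      "\<lbrakk>r \<in> carrier R; l1 \<in> carrier L; l2 \<in> carrier L\<rbrakk> \<Longrightarrow>
        bracket l1 (r \<odot>\<^bsub>L\<^esub> l2) = r \<odot>\<^bsub>L\<^esub> bracket l1 l2 \<oplus>\<^bsub>L\<^esub> anchor l1 r \<odot>\<^bsub>L\<^esub> l2"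

text \<open>For a product \<open>m\<close> on \<open>L\<close>; below it is used with \<open>m l1 l2 = \<nabla> l1 l2\<close>.\<close>

definition commutator :: "('r, 'l, 'z) module_scheme \<Rightarrow> ('l \<Rightarrow> 'l \<Rightarrow> 'l) \<Rightarrow> 'l \<Rightarrow> 'l \<Rightarrow> 'l" where
  "commutator L m l1 l2 = m l1 l2 \<ominus>\<^bsub>L\<^esub> m l2 l1"

definition associator ::
    "('r, 'l, 'z) module_scheme \<Rightarrow> ('l \<Rightarrow> 'l \<Rightarrow> 'l) \<Rightarrow> 'l \<Rightarrow> 'l \<Rightarrow> 'l \<Rightarrow> 'l"
  where
  "associator L m l1 l2 l3 = m l1 (m l2 l3) \<ominus>\<^bsub>L\<^esub> m (m l1 l2) l3"

locale pre_lie_rinehart_algebra = base: algebra K R + L: module R L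
  for K :: "('k, 'x) ring_scheme" and R :: "('k, 'r, 'y) module_scheme"
    and L :: "('r, 'l, 'z) module_scheme" +
  fixes anchor :: "'l \<Rightarrow> 'r \<Rightarrow> 'r" and nabla :: "'l \<Rightarrow> 'l \<Rightarrow> 'l"
  assumes anchor_linear: "anchor \<in> linear_maps R L (der_module K R)"
    and nabla_linear: "(\<lambda>l\<in>carrier L. (nabla l, anchor l)) \<in> linear_maps R L (CDO K R L)"
    and associator_symmetric:
      "\<lbrakk>l1 \<in> carrier L; l2 \<in> carrier L; l3 \<in> carrier L\<rbrakk> \<Longrightarrow>
        associator L nabla l1 l2 l3 = associator L nabla l2 l1 l3"
    and anchor_commutator:
      "\<lbrakk>l1 \<in> carrier L; l2 \<in> carrier L\<rbrakk> \<Longrightarrow>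
        anchor (commutator L nabla l1 l2) = der_bracket R (anchor l1) (anchor l2)"

end

theory Submission
  imports Defs
begin

text \<open>
  Write \<open>a = \<langle>\<alpha>, Y\<rangle>\<close>, \<open>b = \<langle>\<beta>, Y\<rangle>\<close> and let \<open>D\<close> be the Lie derivative along \<open>X\<close>, so that the product
  is \<open>\<alpha> \<cdot> \<beta> = a D\<beta>\<close>. Everything rests on two facts: \<open>D\<close> satisfies the Leibniz rule
  \<open>D(r\<beta>) = r D\<beta> + X(r)\<beta>\<close>, and \<open>\<langle>D\<beta>, Y\<rangle> = X(b) - \<langle>\<beta>, [X,Y]\<rangle>\<close> by the definition of \<open>D\<close>.
  The Leibniz rule says that \<open>aD\<close> is a derivative over the anchor \<open>aX\<close>.

  In the associator \<open>a D(b D\<gamma>) - a \<langle>D\<beta>, Y\<rangle> D\<gamma>\<close> the terms with \<open>X(b)\<close> cancel, and what remains is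
  \<open>a b D(D\<gamma>) + a \<langle>\<beta>, [X,Y]\<rangle> D\<gamma>\<close> (\<open>product_associator\<close>). The first summand is symmetric in
  \<open>\<alpha>\<close> and \<open>\<beta>\<close>, and the second one is symmetric by hypothesis. The same
  symmetry removes the terms with \<open>[X,Y]\<close> from \<open>\<langle>\<alpha> \<cdot> \<beta> - \<beta> \<cdot> \<alpha>, Y\<rangle>\<close>, which leaves the coefficient
  \<open>a X(b) - b X(a)\<close> of \<open>[aX, bX]\<close>; so the anchor respects brackets
  (\<open>anchor_product_commutator\<close>).

  That the commutator is a Lie-Rinehart bracket holds for every pre-Lie-Rinehart algebra
  (\<open>lie_rinehart_commutator\<close>): symmetry of the associator means that left multiplication turns
  commutators into commutators of operators, and the Jacobi identity follows.
\<close>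

section \<open>Pointwise modules and restriction of scalars\<close>

lemma carrier_pointwise_module [simp]: "carrier (pointwise_module S H N) = H"
  by (simp add: pointwise_module_def)

lemma pointwise_module_ops:
  "zero (pointwise_module S H N) = (\<lambda>p\<in>S. \<zero>\<^bsub>N\<^esub>)"
  "add (pointwise_module S H N) = (\<lambda>f g. \<lambda>p\<in>S. f p \<oplus>\<^bsub>N\<^esub> g p)"
  "smult (pointwise_module S H N) = (\<lambda>r f. \<lambda>p\<in>S. r \<odot>\<^bsub>N\<^esub> f p)"
  by (simp_all add: pointwise_module_def)

lemma pointwise_module_apply [simp]:
  assumes "p \<in> S"
  shows "\<zero>\<^bsub>pointwise_module S H N\<^esub> p = \<zero>\<^bsub>N\<^esub>"
    and "(f \<oplus>\<^bsub>pointwise_module S H N\<^esub> g) p = f p \<oplus>\<^bsub>N\<^esub> g p"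
    and "(r \<odot>\<^bsub>pointwise_module S H N\<^esub> f) p = r \<odot>\<^bsub>N\<^esub> f p"
  using assms by (simp_all add: pointwise_module_ops)

lemma self_module_simps [simp]:
  "carrier (self_module R) = carrier R" "zero (self_module R) = zero R"
  "add (self_module R) = add R" "smult (self_module R) = mult R"
  by (simp_all add: self_module_def)

lemma restrict_scalars_simps [simp]:
  "carrier (restrict_scalars R L) = carrier L" "zero (restrict_scalars R L) = zero L"
  "add (restrict_scalars R L) = add L"
  "smult (restrict_scalars R L) = (\<lambda>c l. (c \<odot>\<^bsub>R\<^esub> \<one>\<^bsub>R\<^esub>) \<odot>\<^bsub>L\<^esub> l)"
  by (simp_all add: restrict_scalars_def)

text \<open>
  The zero, the sum and the negative of a module do not involve the remaining record fields, so
  group-theoretic facts pass between records that share the additive part.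
\<close>

lemma a_inv_cong:
  assumes "carrier A = carrier B" "add A = add B" "zero A = zero B"
  shows "a_inv A = a_inv B"
  using assms by (simp add: a_inv_def m_inv_def fun_eq_iff)

lemma abelian_group_cong:
  assumes "abelian_group A" "carrier A = carrier B" "add A = add B" "zero A = zero B"
  shows "abelian_group B"
proof -
  interpret abelian_group A by fact
  have "\<exists>y\<in>carrier A. y \<oplus>\<^bsub>A\<^esub> x = \<zero>\<^bsub>A\<^esub>" if "x \<in> carrier A" for x
    using that l_neg a_inv_closed by blast
  then show ?thesis
    by (intro abelian_groupI) (simp_all flip: assms(2-) add: a_ac)
qed

lemma module_self_module:
  assumes "cring R"
  shows "module R (self_module R)"
proof -
  interpret cring R by fact
  show ?thesis
    using abelian_group_cong[OF is_abelian_group, of "self_module R"]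
    by (intro moduleI) (auto simp: assms l_distr r_distr m_assoc)
qed

text \<open>The scalar action is associative because \<open>c \<mapsto> c \<cdot> 1\<close> is multiplicative.\<close>

lemma module_restrict_scalars:
  assumes "algebra K R" "module R L"
  shows "module K (restrict_scalars R L)"
proof -
  interpret A: algebra K R by fact
  interpret L: module R L by fact
  have "(a \<otimes>\<^bsub>K\<^esub> b) \<odot>\<^bsub>R\<^esub> \<one>\<^bsub>R\<^esub> = (a \<odot>\<^bsub>R\<^esub> \<one>\<^bsub>R\<^esub>) \<otimes>\<^bsub>R\<^esub> (b \<odot>\<^bsub>R\<^esub> \<one>\<^bsub>R\<^esub>)"
    if "a \<in> carrier K" "b \<in> carrier K" for a b
    using that by (simp add: A.smult_assoc1 A.smult_assoc2)
  then show ?thesis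
    using abelian_group_cong[OF L.M.abelian_group_axioms, of "restrict_scalars R L"]
    by (intro moduleI)
      (auto simp: A.R_cring A.smult_l_distr L.smult_l_distr L.smult_r_distr L.smult_assoc1)
qed

text \<open>
  The module axioms hold pointwise. Negatives come for free from closure under scalars, since
  \<open>-f = (-1) f\<close>.
\<close>

lemma
  fixes S H N
  defines "P \<equiv> pointwise_module S H N"
  assumes "module R N" "H \<subseteq> S \<rightarrow>\<^sub>E carrier N" and zero: "\<zero>\<^bsub>P\<^esub> \<in> H"
    and add: "\<And>f g. f \<in> H \<Longrightarrow> g \<in> H \<Longrightarrow> f \<oplus>\<^bsub>P\<^esub> g \<in> H"
    and smult: "\<And>r f. r \<in> carrier R \<Longrightarrow> f \<in> H \<Longrightarrow> r \<odot>\<^bsub>P\<^esub> f \<in> H"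
  shows module_pointwise_module: "module R P"
    and pointwise_module_a_inv: "f \<in> H \<Longrightarrow> p \<in> S \<Longrightarrow> (\<ominus>\<^bsub>P\<^esub> f) p = \<ominus>\<^bsub>N\<^esub> f p"
proof -
  interpret N: module R N by fact
  have ops [simp]: "carrier P = H"
    "\<And>p. p \<in> S \<Longrightarrow> \<zero>\<^bsub>P\<^esub> p = \<zero>\<^bsub>N\<^esub>"
    "\<And>f g p. p \<in> S \<Longrightarrow> (f \<oplus>\<^bsub>P\<^esub> g) p = f p \<oplus>\<^bsub>N\<^esub> g p"
    "\<And>r f p. p \<in> S \<Longrightarrow> (r \<odot>\<^bsub>P\<^esub> f) p = r \<odot>\<^bsub>N\<^esub> f p"
    by (simp_all add: P_def)
  have val [simp]: "f p \<in> carrier N" if "f \<in> H" "p \<in> S" for f p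
    using assms(3) that by auto
  have ext: "f = g" if "f \<in> H" "g \<in> H" "\<And>p. p \<in> S \<Longrightarrow> f p = g p" for f g
    using assms(3) that by (intro PiE_ext[of f S "\<lambda>_. carrier N" g]) auto
  have neg: "((\<ominus>\<^bsub>R\<^esub> \<one>\<^bsub>R\<^esub>) \<odot>\<^bsub>P\<^esub> f) \<oplus>\<^bsub>P\<^esub> f = \<zero>\<^bsub>P\<^esub>" if "f \<in> H" for f
    using that by (intro ext add smult zero) (simp_all add: N.smult_l_minus N.M.l_neg)
  have "abelian_group P"
  proof (rule abelian_groupI)
    show "\<exists>g\<in>carrier P. g \<oplus>\<^bsub>P\<^esub> f = \<zero>\<^bsub>P\<^esub>" if "f \<in> carrier P" for f
      using that neg[of f] smult[of "\<ominus>\<^bsub>R\<^esub> \<one>\<^bsub>R\<^esub>" f] by auto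
    show "f \<oplus>\<^bsub>P\<^esub> g \<oplus>\<^bsub>P\<^esub> h = f \<oplus>\<^bsub>P\<^esub> (g \<oplus>\<^bsub>P\<^esub> h)"
      if "f \<in> carrier P" "g \<in> carrier P" "h \<in> carrier P" for f g h
      using that by (intro ext add) (simp_all add: N.M.a_assoc)
    show "f \<oplus>\<^bsub>P\<^esub> g = g \<oplus>\<^bsub>P\<^esub> f" if "f \<in> carrier P" "g \<in> carrier P" for f g
      using that by (intro ext add) (simp_all add: N.M.a_comm)
    show "\<zero>\<^bsub>P\<^esub> \<oplus>\<^bsub>P\<^esub> f = f" if "f \<in> carrier P" for f
      using that by (intro ext add zero) simp_all
  qed (simp_all add: add zero)
  then interpret P: abelian_group P .
  show "module R P"
  proof (intro moduleI N.is_cring P.abelian_group_axioms)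
    show "(a \<oplus>\<^bsub>R\<^esub> b) \<odot>\<^bsub>P\<^esub> f = a \<odot>\<^bsub>P\<^esub> f \<oplus>\<^bsub>P\<^esub> b \<odot>\<^bsub>P\<^esub> f"
      if "a \<in> carrier R" "b \<in> carrier R" "f \<in> carrier P" for a b f
      using that by (intro ext add smult) (simp_all add: N.smult_l_distr)
    show "a \<odot>\<^bsub>P\<^esub> (f \<oplus>\<^bsub>P\<^esub> g) = a \<odot>\<^bsub>P\<^esub> f \<oplus>\<^bsub>P\<^esub> a \<odot>\<^bsub>P\<^esub> g"
      if "a \<in> carrier R" "f \<in> carrier P" "g \<in> carrier P" for a f g
      using that by (intro ext add smult) (simp_all add: N.smult_r_distr)
    show "(a \<otimes>\<^bsub>R\<^esub> b) \<odot>\<^bsub>P\<^esub> f = a \<odot>\<^bsub>P\<^esub> (b \<odot>\<^bsub>P\<^esub> f)"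
      if "a \<in> carrier R" "b \<in> carrier R" "f \<in> carrier P" for a b f
      using that by (intro ext smult) (simp_all add: N.smult_assoc1)
    show "\<one>\<^bsub>R\<^esub> \<odot>\<^bsub>P\<^esub> f = f" if "f \<in> carrier P" for f
      using that by (intro ext smult) simp_all
  qed (simp_all add: smult)
  show "(\<ominus>\<^bsub>P\<^esub> f) p = \<ominus>\<^bsub>N\<^esub> f p" if "f \<in> H" "p \<in> S"
  proof -
    have "\<ominus>\<^bsub>P\<^esub> f = (\<ominus>\<^bsub>R\<^esub> \<one>\<^bsub>R\<^esub>) \<odot>\<^bsub>P\<^esub> f"
      using that by (intro P.minus_equality neg) (simp_all add: smult)
    then show ?thesis using that by (simp add: N.smult_l_minus)
  qed
qed

section \<open>Pre-Lie-Rinehart algebras\<close>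

lemma linear_mapsD:
  assumes "f \<in> linear_maps R M N"
  shows "x \<in> carrier M \<Longrightarrow> f x \<in> carrier N"
    and "x \<in> carrier M \<Longrightarrow> y \<in> carrier M \<Longrightarrow> f (x \<oplus>\<^bsub>M\<^esub> y) = f x \<oplus>\<^bsub>N\<^esub> f y"
    and "r \<in> carrier R \<Longrightarrow> x \<in> carrier M \<Longrightarrow> f (r \<odot>\<^bsub>M\<^esub> x) = r \<odot>\<^bsub>N\<^esub> f x"
  using assms by (auto simp: linear_maps_def)

context pre_lie_rinehart_algebra
begin

lemma nabla_CDO:
  assumes "x \<in> carrier L"
  shows "nabla x \<in> linear_maps K (restrict_scalars R L) (restrict_scalars R L)"
    and "anchor x \<in> Der K R"
    and "\<And>r y. r \<in> carrier R \<Longrightarrow> y \<in> carrier L \<Longrightarrow>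
           nabla x (r \<odot>\<^bsub>L\<^esub> y) = r \<odot>\<^bsub>L\<^esub> nabla x y \<oplus>\<^bsub>L\<^esub> anchor x r \<odot>\<^bsub>L\<^esub> y"
  using linear_mapsD(1)[OF nabla_linear assms] assms by (simp_all add: CDO_def Let_def)

lemma nabla_closed [simp]:
  "x \<in> carrier L \<Longrightarrow> y \<in> carrier L \<Longrightarrow> nabla x y \<in> carrier L"
  using linear_mapsD(1)[OF nabla_CDO(1)] by simp

lemma anchor_closed [simp]:
  "x \<in> carrier L \<Longrightarrow> r \<in> carrier R \<Longrightarrow> anchor x r \<in> carrier R"
  using nabla_CDO(2) linear_mapsD(1)[of "anchor x" K R R r] by (auto simp: Der_def)

lemma nabla_add_right:
  "x \<in> carrier L \<Longrightarrow> y \<in> carrier L \<Longrightarrow> z \<in> carrier L \<Longrightarrow>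
    nabla x (y \<oplus>\<^bsub>L\<^esub> z) = nabla x y \<oplus>\<^bsub>L\<^esub> nabla x z"
  using linear_mapsD(2)[OF nabla_CDO(1)] by simp

lemma nabla_scalar_right:
  "x \<in> carrier L \<Longrightarrow> y \<in> carrier L \<Longrightarrow> c \<in> carrier K \<Longrightarrow>
    nabla x ((c \<odot>\<^bsub>R\<^esub> \<one>\<^bsub>R\<^esub>) \<odot>\<^bsub>L\<^esub> y) = (c \<odot>\<^bsub>R\<^esub> \<one>\<^bsub>R\<^esub>) \<odot>\<^bsub>L\<^esub> nabla x y"
  using linear_mapsD(3)[OF nabla_CDO(1)] by simp

lemma nabla_add_left:
  "x \<in> carrier L \<Longrightarrow> y \<in> carrier L \<Longrightarrow> z \<in> carrier L \<Longrightarrow>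
    nabla (x \<oplus>\<^bsub>L\<^esub> y) z = nabla x z \<oplus>\<^bsub>L\<^esub> nabla y z"
  using linear_mapsD(2)[OF nabla_linear, of x y] by (simp add: CDO_def Let_def)

lemma nabla_smult_left:
  "r \<in> carrier R \<Longrightarrow> x \<in> carrier L \<Longrightarrow> y \<in> carrier L \<Longrightarrow>
    nabla (r \<odot>\<^bsub>L\<^esub> x) y = r \<odot>\<^bsub>L\<^esub> nabla x y"
  using linear_mapsD(3)[OF nabla_linear, of r x] by (simp add: CDO_def Let_def)

text \<open>Used for both arguments of \<open>nabla\<close>, whose additivity is stated for sums only.\<close>

lemma additive_minus:
  assumes "\<And>x. x \<in> carrier L \<Longrightarrow> f x \<in> carrier L"
    and add: "\<And>x y. x \<in> carrier L \<Longrightarrow> y \<in> carrier L \<Longrightarrow> f (x \<oplus>\<^bsub>L\<^esub> y) = f x \<oplus>\<^bsub>L\<^esub> f y"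
    and "x \<in> carrier L" "y \<in> carrier L"
  shows "f (x \<ominus>\<^bsub>L\<^esub> y) = f x \<ominus>\<^bsub>L\<^esub> f y"
proof -
  have "f (x \<ominus>\<^bsub>L\<^esub> y) \<oplus>\<^bsub>L\<^esub> f y = f x"
    using assms(3,4) by (simp add: add[symmetric] a_minus_def L.M.a_assoc L.M.l_neg)
  then show ?thesis
    using assms by (metis L.M.minus_closed L.M.add.inv_solve_right L.M.minus_eq)
qed

lemma nabla_minus_right:
  "x \<in> carrier L \<Longrightarrow> y \<in> carrier L \<Longrightarrow> z \<in> carrier L \<Longrightarrow>
    nabla x (y \<ominus>\<^bsub>L\<^esub> z) = nabla x y \<ominus>\<^bsub>L\<^esub> nabla x z"
  by (rule additive_minus) (auto simp: nabla_add_right)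

lemma nabla_minus_left:
  "x \<in> carrier L \<Longrightarrow> y \<in> carrier L \<Longrightarrow> z \<in> carrier L \<Longrightarrow>
    nabla (x \<ominus>\<^bsub>L\<^esub> y) z = nabla x z \<ominus>\<^bsub>L\<^esub> nabla y z"
  by (rule additive_minus[of "\<lambda>x. nabla x z"]) (auto simp: nabla_add_left)

lemmas group_simps = a_minus_def L.M.minus_add L.M.a_assoc L.M.a_comm L.M.a_lcomm

text \<open>
  Solving the symmetry of the associator for the terms \<open>(x \<cdot> y) \<cdot> z - (y \<cdot> x) \<cdot> z\<close>: \<open>nabla\<close> is a
  representation of the commutator bracket, that is, a flat connection.
\<close>

lemma nabla_commutator:
  assumes "x \<in> carrier L" "y \<in> carrier L" "z \<in> carrier L"
  shows "nabla (commutator L nabla x y) z = nabla x (nabla y z) \<ominus>\<^bsub>L\<^esub> nabla y (nabla x z)"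
proof -
  let ?xy = "nabla (nabla x y) z" and ?yx = "nabla (nabla y x) z"
  have "nabla x (nabla y z) = (nabla x (nabla y z) \<ominus>\<^bsub>L\<^esub> ?xy) \<oplus>\<^bsub>L\<^esub> ?xy"
    using assms by (simp add: a_minus_def L.M.a_assoc L.M.l_neg)
  also have "\<dots> = (nabla y (nabla x z) \<ominus>\<^bsub>L\<^esub> ?yx) \<oplus>\<^bsub>L\<^esub> ?xy"
    using associator_symmetric[OF assms] by (simp add: associator_def)
  finally have "nabla x (nabla y z) \<ominus>\<^bsub>L\<^esub> nabla y (nabla x z)
      = (nabla y (nabla x z) \<ominus>\<^bsub>L\<^esub> nabla y (nabla x z)) \<oplus>\<^bsub>L\<^esub> (?xy \<ominus>\<^bsub>L\<^esub> ?yx)"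
    using assms by (simp only: group_simps nabla_closed L.M.a_closed L.M.a_inv_closed)
  then show ?thesis
    using assms by (simp add: commutator_def nabla_minus_left) (simp add: a_minus_def L.M.r_neg)
qed

text \<open>
  By flatness \<open>[x,[y,z]]\<close> becomes a combination of four right-nested products
  \<open>u \<cdot> (v \<cdot> w)\<close>. The cyclic sum contains each of the six such products once with either sign.
\<close>

lemma commutator_jacobi:
  assumes "x \<in> carrier L" "y \<in> carrier L" "z \<in> carrier L"
  defines "b \<equiv> commutator L nabla"
  shows "b x (b y z) \<oplus>\<^bsub>L\<^esub> b y (b z x) \<oplus>\<^bsub>L\<^esub> b z (b x y) = \<zero>\<^bsub>L\<^esub>"
proof -
  have expand: "b x (b y z) = (nabla x (nabla y z) \<ominus>\<^bsub>L\<^esub> nabla x (nabla z y))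
      \<ominus>\<^bsub>L\<^esub> (nabla y (nabla z x) \<ominus>\<^bsub>L\<^esub> nabla z (nabla y x))"
    if "x \<in> carrier L" "y \<in> carrier L" "z \<in> carrier L" for x y z
    using nabla_commutator[of y z x] that
    by (simp add: b_def commutator_def nabla_minus_right)
  \<comment> \<open>The letters stand for the six products \<open>x(yz)\<close>, \<open>x(zy)\<close>, \<open>y(zx)\<close>, \<open>z(yx)\<close>, \<open>y(xz)\<close>, \<open>z(xy)\<close>.\<close>
  have cancel: "((p \<ominus>\<^bsub>L\<^esub> q) \<ominus>\<^bsub>L\<^esub> (r \<ominus>\<^bsub>L\<^esub> s)) \<oplus>\<^bsub>L\<^esub> ((r \<ominus>\<^bsub>L\<^esub> t) \<ominus>\<^bsub>L\<^esub> (u \<ominus>\<^bsub>L\<^esub> q))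
      \<oplus>\<^bsub>L\<^esub> ((u \<ominus>\<^bsub>L\<^esub> s) \<ominus>\<^bsub>L\<^esub> (p \<ominus>\<^bsub>L\<^esub> t)) = \<zero>\<^bsub>L\<^esub>"
    if "p \<in> carrier L" "q \<in> carrier L" "r \<in> carrier L" "s \<in> carrier L"
      "t \<in> carrier L" "u \<in> carrier L" for p q r s t u
  proof -
    have "?thesis \<longleftrightarrow> (p \<ominus>\<^bsub>L\<^esub> p) \<oplus>\<^bsub>L\<^esub> (q \<ominus>\<^bsub>L\<^esub> q) \<oplus>\<^bsub>L\<^esub> (r \<ominus>\<^bsub>L\<^esub> r) \<oplus>\<^bsub>L\<^esub> (s \<ominus>\<^bsub>L\<^esub> s)
      \<oplus>\<^bsub>L\<^esub> (t \<ominus>\<^bsub>L\<^esub> t) \<oplus>\<^bsub>L\<^esub> (u \<ominus>\<^bsub>L\<^esub> u) = \<zero>\<^bsub>L\<^esub>"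
      using that by (simp only: group_simps L.M.a_closed L.M.a_inv_closed L.M.minus_minus)
    then show ?thesis
      using that by (simp add: a_minus_def L.M.r_neg)
  qed
  show ?thesis
    using assms(1-3) by (simp only: expand cancel nabla_closed)
qed

lemma commutator_linear_right:
  assumes "x \<in> carrier L"
  shows "(\<lambda>y\<in>carrier L. commutator L nabla x y)
    \<in> linear_maps K (restrict_scalars R L) (restrict_scalars R L)"
  using assms
  by (auto simp: linear_maps_def commutator_def nabla_add_left nabla_add_right
      nabla_scalar_right nabla_smult_left group_simps L.smult_r_distr L.smult_r_minus)

lemma commutator_linear_left:
  assumes "y \<in> carrier L"
  shows "(\<lambda>x\<in>carrier L. commutator L nabla x y)
    \<in> linear_maps K (restrict_scalars R L) (restrict_scalars R L)"
  using assms
  by (auto simp: linear_maps_def commutator_def nabla_add_left nabla_add_right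
      nabla_scalar_right nabla_smult_left group_simps L.smult_r_distr L.smult_r_minus)

theorem lie_rinehart_commutator: "lie_rinehart_algebra K R L (commutator L nabla) anchor"
proof (intro lie_rinehart_algebra.intro base.algebra_axioms L.module_axioms
    lie_rinehart_algebra_axioms.intro lie_algebra.intro lie_algebra_axioms.intro)
  show "module K (restrict_scalars R L)"
    by (rule module_restrict_scalars) (rule base.algebra_axioms L.module_axioms)+
  show "commutator L nabla x (r \<odot>\<^bsub>L\<^esub> y)
      = r \<odot>\<^bsub>L\<^esub> commutator L nabla x y \<oplus>\<^bsub>L\<^esub> anchor x r \<odot>\<^bsub>L\<^esub> y"
    if "r \<in> carrier R" "x \<in> carrier L" "y \<in> carrier L" for r x y
    using that by (simp add: commutator_def nabla_CDO(3) nabla_smult_left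
        group_simps L.smult_r_distr L.smult_r_minus)
qed (use anchor_linear anchor_commutator commutator_linear_right commutator_linear_left
      commutator_jacobi in \<open>simp_all add: commutator_def a_minus_def L.M.r_neg\<close>)

end
section \<open>Derivations and one-forms\<close>

locale derivation_calculus = A?: algebra K R for K and R (structure)
begin

abbreviation "T \<equiv> der_module K R"
abbreviation "\<Omega> \<equiv> one_forms K R"

lemma scalar_mult_right:
  assumes "c \<in> carrier K" "a \<in> carrier R" "b \<in> carrier R"
  shows "a \<otimes> (c \<odot> b) = c \<odot> (a \<otimes> b)"
  using assms A.smult_assoc2[of c b a] by (simp add: m_comm)

lemma DerI:
  assumes "X \<in> carrier R \<rightarrow>\<^sub>E carrier R"
    and "\<And>a b. a \<in> carrier R \<Longrightarrow> b \<in> carrier R \<Longrightarrow> X (a \<oplus> b) = X a \<oplus> X b"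
    and "\<And>c a. c \<in> carrier K \<Longrightarrow> a \<in> carrier R \<Longrightarrow> X (c \<odot> a) = c \<odot> X a"
    and "\<And>a b. a \<in> carrier R \<Longrightarrow> b \<in> carrier R \<Longrightarrow> X (a \<otimes> b) = X a \<otimes> b \<oplus> a \<otimes> X b"
  shows "X \<in> Der K R"
  using assms by (simp add: Der_def linear_maps_def)

lemma
  assumes "X \<in> Der K R"
  shows Der_closed [simp]: "a \<in> carrier R \<Longrightarrow> X a \<in> carrier R"
    and Der_add: "a \<in> carrier R \<Longrightarrow> b \<in> carrier R \<Longrightarrow> X (a \<oplus> b) = X a \<oplus> X b"
    and Der_scalar: "c \<in> carrier K \<Longrightarrow> a \<in> carrier R \<Longrightarrow> X (c \<odot> a) = c \<odot> X a"
    and Der_mult: "a \<in> carrier R \<Longrightarrow> b \<in> carrier R \<Longrightarrow> X (a \<otimes> b) = X a \<otimes> b \<oplus> a \<otimes> X b"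
    and Der_extensional: "X \<in> carrier R \<rightarrow>\<^sub>E carrier R"
  using assms by (auto simp: Der_def linear_maps_def)

lemma Der_eqI:
  assumes "X \<in> Der K R" "Y \<in> Der K R" "\<And>a. a \<in> carrier R \<Longrightarrow> X a = Y a"
  shows "X = Y"
  using assms Der_extensional by (intro PiE_ext[of X "carrier R" "\<lambda>_. carrier R" Y]) auto

text \<open>
  Makes operators that satisfy the Leibniz rule over \<open>X\<close> linear over \<open>K\<close>, which acts through
  \<open>c \<mapsto> c \<cdot> 1\<close>.
\<close>

lemma Der_constant:
  assumes X: "X \<in> Der K R" and "c \<in> carrier K"
  shows "X (c \<odot> \<one>) = \<zero>"
proof -
  have "X \<one> = X \<one> \<oplus> X \<one>" using Der_mult[OF X, of \<one> \<one>] X by simp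
  then have "X \<one> = \<zero>" using X by (metis Der_closed M.add.r_cancel_one' one_closed)
  then show ?thesis using Der_scalar[OF X, of c \<one>] assms by simp
qed

lemma
  shows carrier_T [simp]: "carrier T = Der K R"
    and T_apply [simp]: "a \<in> carrier R \<Longrightarrow> \<zero>\<^bsub>T\<^esub> a = \<zero>"
    "a \<in> carrier R \<Longrightarrow> (X \<oplus>\<^bsub>T\<^esub> Y) a = X a \<oplus> Y a"
    "a \<in> carrier R \<Longrightarrow> (r \<odot>\<^bsub>T\<^esub> X) a = r \<otimes> X a"
  by (simp_all add: der_module_def)

lemma T_extensional:
  "X \<in> Der K R \<Longrightarrow> Y \<in> Der K R \<Longrightarrow> X \<oplus>\<^bsub>T\<^esub> Y \<in> carrier R \<rightarrow>\<^sub>E carrier R"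
  "r \<in> carrier R \<Longrightarrow> X \<in> Der K R \<Longrightarrow> r \<odot>\<^bsub>T\<^esub> X \<in> carrier R \<rightarrow>\<^sub>E carrier R"
  "\<zero>\<^bsub>T\<^esub> \<in> carrier R \<rightarrow>\<^sub>E carrier R"
  by (auto simp: der_module_def pointwise_module_ops)

lemma Der_plus_closed [simp]:
  assumes X: "X \<in> Der K R" and Y: "Y \<in> Der K R"
  shows "X \<oplus>\<^bsub>T\<^esub> Y \<in> Der K R"
proof (rule DerI)
  fix a b assume ab: "a \<in> carrier R" "b \<in> carrier R"
  note cl = ab ab[THEN Der_closed[OF X]] ab[THEN Der_closed[OF Y]]
  show "(X \<oplus>\<^bsub>T\<^esub> Y) (a \<oplus> b) = (X \<oplus>\<^bsub>T\<^esub> Y) a \<oplus> (X \<oplus>\<^bsub>T\<^esub> Y) b"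
    using cl by (simp add: Der_add[OF X] Der_add[OF Y]) algebra
  show "(X \<oplus>\<^bsub>T\<^esub> Y) (a \<otimes> b) = (X \<oplus>\<^bsub>T\<^esub> Y) a \<otimes> b \<oplus> a \<otimes> (X \<oplus>\<^bsub>T\<^esub> Y) b"
    using cl by (simp add: Der_mult[OF X] Der_mult[OF Y]) algebra
qed (use T_extensional(1)[OF X Y] X Y in \<open>simp_all add: Der_scalar A.smult_r_distr\<close>)

lemma Der_smult_closed [simp]:
  assumes r: "r \<in> carrier R" and X: "X \<in> Der K R"
  shows "r \<odot>\<^bsub>T\<^esub> X \<in> Der K R"
proof (rule DerI)
  fix a b assume ab: "a \<in> carrier R" "b \<in> carrier R"
  note cl = r ab ab[THEN Der_closed[OF X]]
  show "(r \<odot>\<^bsub>T\<^esub> X) (a \<oplus> b) = (r \<odot>\<^bsub>T\<^esub> X) a \<oplus> (r \<odot>\<^bsub>T\<^esub> X) b"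
    using cl by (simp add: Der_add[OF X]) algebra
  show "(r \<odot>\<^bsub>T\<^esub> X) (a \<otimes> b) = (r \<odot>\<^bsub>T\<^esub> X) a \<otimes> b \<oplus> a \<otimes> (r \<odot>\<^bsub>T\<^esub> X) b"
    using cl by (simp add: Der_mult[OF X]) algebra
qed (use T_extensional(2)[OF r X] X r in \<open>simp_all add: Der_scalar scalar_mult_right\<close>)

lemma Der_zero_closed [simp]: "\<zero>\<^bsub>T\<^esub> \<in> Der K R"
  using T_extensional(3) by (intro DerI) simp_all

lemma module_T: "module R T"
  unfolding der_module_def
  by (rule module_pointwise_module)
    (use Der_extensional in \<open>auto simp flip: der_module_def intro: module_self_module is_cring\<close>)

lemma der_bracket_apply [simp]:
  "a \<in> carrier R \<Longrightarrow> der_bracket R X Y a = X (Y a) \<ominus> Y (X a)"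
  by (simp add: der_bracket_def)

lemma der_bracket_closed [simp]:
  assumes X: "X \<in> Der K R" and Y: "Y \<in> Der K R"
  shows "der_bracket R X Y \<in> Der K R"
proof (rule DerI)
  show "der_bracket R X Y \<in> carrier R \<rightarrow>\<^sub>E carrier R"
    using X Y by (auto simp: der_bracket_def)
next
  fix a b assume ab: "a \<in> carrier R" "b \<in> carrier R"
  note X1 = ab[THEN Der_closed[OF X]] and Y1 = ab[THEN Der_closed[OF Y]]
  note cl = ab X1 Y1 X1[THEN Der_closed[OF Y]] Y1[THEN Der_closed[OF X]]
  show "der_bracket R X Y (a \<oplus> b) = der_bracket R X Y a \<oplus> der_bracket R X Y b"
    using cl by (simp add: Der_add[OF X] Der_add[OF Y]) algebra
  show "der_bracket R X Y (a \<otimes> b) = der_bracket R X Y a \<otimes> b \<oplus> a \<otimes> der_bracket R X Y b"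
    using cl by (simp add: Der_add[OF X] Der_add[OF Y] Der_mult[OF X] Der_mult[OF Y]) algebra
next
  fix c a assume "c \<in> carrier K" "a \<in> carrier R"
  then show "der_bracket R X Y (c \<odot> a) = c \<odot> der_bracket R X Y a"
    using X Y by (simp add: Der_scalar a_minus_def A.smult_r_distr A.smult_r_minus)
qed

lemma der_bracket_add:
  assumes X: "X \<in> Der K R" and Y: "Y \<in> Der K R" and Z: "Z \<in> Der K R"
  shows "der_bracket R X (Y \<oplus>\<^bsub>T\<^esub> Z) = der_bracket R X Y \<oplus>\<^bsub>T\<^esub> der_bracket R X Z"
proof (rule Der_eqI)
  fix a assume a: "a \<in> carrier R"
  note cl = Der_closed[OF X Der_closed[OF Y a]] Der_closed[OF X Der_closed[OF Z a]]
    Der_closed[OF Y Der_closed[OF X a]] Der_closed[OF Z Der_closed[OF X a]]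
  show "der_bracket R X (Y \<oplus>\<^bsub>T\<^esub> Z) a = (der_bracket R X Y \<oplus>\<^bsub>T\<^esub> der_bracket R X Z) a"
    using a assms by (simp add: Der_add[OF X]) (use cl in algebra)
qed (use assms in simp_all)

text \<open>
  The bracket is not \<open>R\<close>-linear in its second argument; the defect \<open>X(r) Y\<close> is what the term \<open>X(\<alpha>(Z))\<close> of the Lie derivative
  compensates, and this is why the Lie derivative of a one-form is again \<open>R\<close>-linear.
\<close>

lemma der_bracket_smult:
  assumes X: "X \<in> Der K R" and r: "r \<in> carrier R" and Y: "Y \<in> Der K R"
  shows "der_bracket R X (r \<odot>\<^bsub>T\<^esub> Y) = r \<odot>\<^bsub>T\<^esub> der_bracket R X Y \<oplus>\<^bsub>T\<^esub> X r \<odot>\<^bsub>T\<^esub> Y"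
proof (rule Der_eqI)
  fix a assume a: "a \<in> carrier R"
  note cl = r a Der_closed[OF X r] Der_closed[OF Y a]
    Der_closed[OF X Der_closed[OF Y a]] Der_closed[OF Y Der_closed[OF X a]]
  show "der_bracket R X (r \<odot>\<^bsub>T\<^esub> Y) a
      = (r \<odot>\<^bsub>T\<^esub> der_bracket R X Y \<oplus>\<^bsub>T\<^esub> X r \<odot>\<^bsub>T\<^esub> Y) a"
    using a assms by (simp add: Der_mult[OF X]) (use cl in algebra)
qed (use assms in simp_all)

lemma one_formI:
  assumes "\<alpha> \<in> Der K R \<rightarrow>\<^sub>E carrier R"
    and "\<And>Y Z. Y \<in> Der K R \<Longrightarrow> Z \<in> Der K R \<Longrightarrow> \<alpha> (Y \<oplus>\<^bsub>T\<^esub> Z) = \<alpha> Y \<oplus> \<alpha> Z"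
    and "\<And>r Z. r \<in> carrier R \<Longrightarrow> Z \<in> Der K R \<Longrightarrow> \<alpha> (r \<odot>\<^bsub>T\<^esub> Z) = r \<otimes> \<alpha> Z"
  shows "\<alpha> \<in> carrier \<Omega>"
  using assms by (simp add: one_forms_def hom_module_def linear_maps_def)

lemma
  assumes "\<alpha> \<in> carrier \<Omega>"
  shows one_form_closed [simp]: "Z \<in> Der K R \<Longrightarrow> \<alpha> Z \<in> carrier R"
    and one_form_add: "Y \<in> Der K R \<Longrightarrow> Z \<in> Der K R \<Longrightarrow> \<alpha> (Y \<oplus>\<^bsub>T\<^esub> Z) = \<alpha> Y \<oplus> \<alpha> Z"
    and one_form_smult: "r \<in> carrier R \<Longrightarrow> Z \<in> Der K R \<Longrightarrow> \<alpha> (r \<odot>\<^bsub>T\<^esub> Z) = r \<otimes> \<alpha> Z"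
    and one_form_extensional: "\<alpha> \<in> Der K R \<rightarrow>\<^sub>E carrier R"
  using assms by (auto simp: one_forms_def hom_module_def linear_maps_def)

lemma one_form_eqI:
  assumes "\<alpha> \<in> carrier \<Omega>" "\<beta> \<in> carrier \<Omega>" "\<And>Z. Z \<in> Der K R \<Longrightarrow> \<alpha> Z = \<beta> Z"
  shows "\<alpha> = \<beta>"
  using assms one_form_extensional by (intro PiE_ext[of \<alpha> "Der K R" "\<lambda>_. carrier R" \<beta>]) auto

lemma one_forms_apply [simp]:
  assumes "Z \<in> Der K R"
  shows "\<zero>\<^bsub>\<Omega>\<^esub> Z = \<zero>" "(\<alpha> \<oplus>\<^bsub>\<Omega>\<^esub> \<beta>) Z = \<alpha> Z \<oplus> \<beta> Z" "(r \<odot>\<^bsub>\<Omega>\<^esub> \<alpha>) Z = r \<otimes> \<alpha> Z"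
  using assms by (simp_all add: one_forms_def hom_module_def)

lemma \<Omega>_extensional:
  "\<alpha> \<in> carrier \<Omega> \<Longrightarrow> \<beta> \<in> carrier \<Omega> \<Longrightarrow> \<alpha> \<oplus>\<^bsub>\<Omega>\<^esub> \<beta> \<in> Der K R \<rightarrow>\<^sub>E carrier R"
  "r \<in> carrier R \<Longrightarrow> \<alpha> \<in> carrier \<Omega> \<Longrightarrow> r \<odot>\<^bsub>\<Omega>\<^esub> \<alpha> \<in> Der K R \<rightarrow>\<^sub>E carrier R"
  "\<zero>\<^bsub>\<Omega>\<^esub> \<in> Der K R \<rightarrow>\<^sub>E carrier R"
  using one_form_closed by (auto simp: one_forms_def hom_module_def pointwise_module_ops)

lemma one_forms_plus_closed:
  assumes \<alpha>: "\<alpha> \<in> carrier \<Omega>" and \<beta>: "\<beta> \<in> carrier \<Omega>"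
  shows "\<alpha> \<oplus>\<^bsub>\<Omega>\<^esub> \<beta> \<in> carrier \<Omega>"
proof (rule one_formI)
  fix Y Z assume YZ: "Y \<in> Der K R" "Z \<in> Der K R"
  note cl = YZ[THEN one_form_closed[OF \<alpha>]] YZ[THEN one_form_closed[OF \<beta>]]
  show "(\<alpha> \<oplus>\<^bsub>\<Omega>\<^esub> \<beta>) (Y \<oplus>\<^bsub>T\<^esub> Z) = (\<alpha> \<oplus>\<^bsub>\<Omega>\<^esub> \<beta>) Y \<oplus> (\<alpha> \<oplus>\<^bsub>\<Omega>\<^esub> \<beta>) Z"
    using YZ by (simp add: one_form_add[OF \<alpha>] one_form_add[OF \<beta>]) (use cl in algebra)
qed (use \<Omega>_extensional(1)[OF \<alpha> \<beta>] \<alpha> \<beta> in \<open>simp_all add: one_form_smult r_distr\<close>)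

lemma one_forms_smult_closed:
  assumes r: "r \<in> carrier R" and \<alpha>: "\<alpha> \<in> carrier \<Omega>"
  shows "r \<odot>\<^bsub>\<Omega>\<^esub> \<alpha> \<in> carrier \<Omega>"
  by (rule one_formI) (use \<Omega>_extensional(2)[OF r \<alpha>] \<alpha> r in
    \<open>simp_all add: one_form_add one_form_smult r_distr m_lcomm\<close>)

lemma one_forms_zero_closed: "\<zero>\<^bsub>\<Omega>\<^esub> \<in> carrier \<Omega>"
  using \<Omega>_extensional(3) by (intro one_formI) simp_all

lemma
  shows module_one_forms: "module R \<Omega>"
    and one_forms_a_inv_apply: "\<alpha> \<in> carrier \<Omega> \<Longrightarrow> Z \<in> Der K R \<Longrightarrow> (\<ominus>\<^bsub>\<Omega>\<^esub> \<alpha>) Z = \<ominus> \<alpha> Z"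
proof -
  have \<Omega>: "\<Omega> = pointwise_module (Der K R) (carrier \<Omega>) (self_module R)"
    by (simp add: one_forms_def hom_module_def)
  note prems = module_self_module[OF is_cring] one_form_extensional one_forms_zero_closed
    one_forms_plus_closed one_forms_smult_closed
  have inv: "a_inv (self_module R) = a_inv R"
    by (intro a_inv_cong) simp_all
  show "module R \<Omega>"
    using module_pointwise_module[of R "self_module R" "carrier \<Omega>" "Der K R", folded \<Omega>] prems
    by auto
  show "(\<ominus>\<^bsub>\<Omega>\<^esub> \<alpha>) Z = \<ominus> \<alpha> Z" if "\<alpha> \<in> carrier \<Omega>" "Z \<in> Der K R"
    using pointwise_module_a_inv[of R "self_module R" "carrier \<Omega>" "Der K R", folded \<Omega>] prems that
    by (auto simp: inv)
qed

sublocale \<Omega>: module R \<Omega>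
  by (rule module_one_forms)

lemma one_forms_minus_apply [simp]:
  "\<alpha> \<in> carrier \<Omega> \<Longrightarrow> \<beta> \<in> carrier \<Omega> \<Longrightarrow> Z \<in> Der K R \<Longrightarrow> (\<alpha> \<ominus>\<^bsub>\<Omega>\<^esub> \<beta>) Z = \<alpha> Z \<ominus> \<beta> Z"
  by (simp add: a_minus_def one_forms_a_inv_apply)

lemma lie_derivative_apply:
  "Z \<in> Der K R \<Longrightarrow> lie_derivative K R X \<alpha> Z = X (\<alpha> Z) \<ominus> \<alpha> (der_bracket R X Z)"
  by (simp add: lie_derivative_def)

lemma lie_derivative_closed [simp]:
  assumes X: "X \<in> Der K R" and \<alpha>: "\<alpha> \<in> carrier \<Omega>"
  shows "lie_derivative K R X \<alpha> \<in> carrier \<Omega>"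
proof (rule one_formI)
  show "lie_derivative K R X \<alpha> \<in> Der K R \<rightarrow>\<^sub>E carrier R"
    using X \<alpha> by (auto simp: lie_derivative_def)
next
  fix Y Z assume YZ: "Y \<in> Der K R" "Z \<in> Der K R"
  note cl = YZ[THEN der_bracket_closed[OF X], THEN one_form_closed[OF \<alpha>]]
    YZ[THEN one_form_closed[OF \<alpha>], THEN Der_closed[OF X]]
  show "lie_derivative K R X \<alpha> (Y \<oplus>\<^bsub>T\<^esub> Z)
      = lie_derivative K R X \<alpha> Y \<oplus> lie_derivative K R X \<alpha> Z"
    using X \<alpha> YZ
    by (simp add: lie_derivative_apply der_bracket_add one_form_add Der_add) (use cl in algebra)
next
  fix r Z assume r: "r \<in> carrier R" and Z: "Z \<in> Der K R"
  note cl = r Der_closed[OF X r] one_form_closed[OF \<alpha> Z]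
    one_form_closed[OF \<alpha> der_bracket_closed[OF X Z]] Der_closed[OF X one_form_closed[OF \<alpha> Z]]
  show "lie_derivative K R X \<alpha> (r \<odot>\<^bsub>T\<^esub> Z) = r \<otimes> lie_derivative K R X \<alpha> Z"
    using X \<alpha> r Z
    by (simp add: lie_derivative_apply der_bracket_smult one_form_add one_form_smult Der_mult)
      (use cl in algebra)
qed

lemma lie_derivative_add:
  assumes X: "X \<in> Der K R" and \<alpha>: "\<alpha> \<in> carrier \<Omega>" and \<beta>: "\<beta> \<in> carrier \<Omega>"
  shows "lie_derivative K R X (\<alpha> \<oplus>\<^bsub>\<Omega>\<^esub> \<beta>) = lie_derivative K R X \<alpha> \<oplus>\<^bsub>\<Omega>\<^esub> lie_derivative K R X \<beta>"
proof (rule one_form_eqI)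
  fix Z assume Z: "Z \<in> Der K R"
  note cl = \<alpha>[THEN one_form_closed, OF der_bracket_closed[OF X Z]]
    \<beta>[THEN one_form_closed, OF der_bracket_closed[OF X Z]]
    Der_closed[OF X one_form_closed[OF \<alpha> Z]] Der_closed[OF X one_form_closed[OF \<beta> Z]]
  show "lie_derivative K R X (\<alpha> \<oplus>\<^bsub>\<Omega>\<^esub> \<beta>) Z
      = (lie_derivative K R X \<alpha> \<oplus>\<^bsub>\<Omega>\<^esub> lie_derivative K R X \<beta>) Z"
    using assms Z by (simp add: lie_derivative_apply Der_add) (use cl in algebra)
qed (use assms in simp_all)

text \<open>The Leibniz rule: the Lie derivative along \<open>X\<close> is a derivative over \<open>X\<close>.\<close>

lemma lie_derivative_smult:
  assumes X: "X \<in> Der K R" and r: "r \<in> carrier R" and \<alpha>: "\<alpha> \<in> carrier \<Omega>"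
  shows "lie_derivative K R X (r \<odot>\<^bsub>\<Omega>\<^esub> \<alpha>) = r \<odot>\<^bsub>\<Omega>\<^esub> lie_derivative K R X \<alpha> \<oplus>\<^bsub>\<Omega>\<^esub> X r \<odot>\<^bsub>\<Omega>\<^esub> \<alpha>"
proof (rule one_form_eqI)
  fix Z assume Z: "Z \<in> Der K R"
  note cl = r Der_closed[OF X r] one_form_closed[OF \<alpha> Z]
    one_form_closed[OF \<alpha> der_bracket_closed[OF X Z]] Der_closed[OF X one_form_closed[OF \<alpha> Z]]
  show "lie_derivative K R X (r \<odot>\<^bsub>\<Omega>\<^esub> \<alpha>) Z
      = (r \<odot>\<^bsub>\<Omega>\<^esub> lie_derivative K R X \<alpha> \<oplus>\<^bsub>\<Omega>\<^esub> X r \<odot>\<^bsub>\<Omega>\<^esub> \<alpha>) Z"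
    using assms Z by (simp add: lie_derivative_apply Der_mult) (use cl in algebra)
qed (use assms in simp_all)

end

section \<open>The product on one-forms\<close>

text \<open>
  The Leibniz rule contributes \<open>\<alpha>(Y) X(\<beta>(Y)) D\<gamma>\<close> to the first term of the associator, and
  \<open>(D\<beta>)(Y) = X(\<beta>(Y)) - \<beta>([X,Y])\<close> takes it away again in the second, up to the bracket term.
\<close>

lemma (in derivation_calculus) product_associator:
  assumes X: "X \<in> Der K R" and Y: "Y \<in> Der K R"
    and \<alpha>: "\<alpha> \<in> carrier \<Omega>" and \<beta>: "\<beta> \<in> carrier \<Omega>" and \<gamma>: "\<gamma> \<in> carrier \<Omega>"
  defines "D \<equiv> lie_derivative K R X"
  shows "\<alpha> Y \<odot>\<^bsub>\<Omega>\<^esub> D (\<beta> Y \<odot>\<^bsub>\<Omega>\<^esub> D \<gamma>) \<ominus>\<^bsub>\<Omega>\<^esub> (\<alpha> Y \<odot>\<^bsub>\<Omega>\<^esub> D \<beta>) Y \<odot>\<^bsub>\<Omega>\<^esub> D \<gamma>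
    = (\<alpha> Y \<otimes> \<beta> Y) \<odot>\<^bsub>\<Omega>\<^esub> D (D \<gamma>) \<oplus>\<^bsub>\<Omega>\<^esub> (\<alpha> Y \<otimes> \<beta> (der_bracket R X Y)) \<odot>\<^bsub>\<Omega>\<^esub> D \<gamma>"
    (is "?l = ?r")
proof (rule one_form_eqI)
  have D [simp]: "D \<delta> \<in> carrier \<Omega>" if "\<delta> \<in> carrier \<Omega>" for \<delta>
    using X that by (simp add: D_def)
  show "?l \<in> carrier \<Omega>" "?r \<in> carrier \<Omega>"
    using assms by simp_all
  fix Z assume Z: "Z \<in> Der K R"
  have cl: "\<alpha> Y \<in> carrier R" "\<beta> Y \<in> carrier R" "X (\<beta> Y) \<in> carrier R"
      "\<beta> (der_bracket R X Y) \<in> carrier R" "D \<gamma> Z \<in> carrier R" "D (D \<gamma>) Z \<in> carrier R"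
    using assms(1-5) Z by simp_all
  have \<beta>Y: "D \<beta> Y = X (\<beta> Y) \<ominus> \<beta> (der_bracket R X Y)"
    using Y by (simp add: D_def lie_derivative_apply)
  have leibniz: "D (\<beta> Y \<odot>\<^bsub>\<Omega>\<^esub> D \<gamma>) = \<beta> Y \<odot>\<^bsub>\<Omega>\<^esub> D (D \<gamma>) \<oplus>\<^bsub>\<Omega>\<^esub> X (\<beta> Y) \<odot>\<^bsub>\<Omega>\<^esub> D \<gamma>"
    using X Y \<beta> \<gamma> by (simp add: D_def lie_derivative_smult)
  show "?l Z = ?r Z"
    using assms(1-5) Z by (simp add: leibniz \<beta>Y) (use cl in algebra)
qed

text \<open>
  Symmetry cancels the two bracket terms in the value of the commutator at \<open>Y\<close>. What is left is
  the coefficient of \<open>X\<close> in \<open>[aX, bX] = (a X(b) - b X(a)) X\<close>, in which the second-order terms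
  \<open>a b X(X(r))\<close> cancel.
\<close>

lemma (in derivation_calculus) anchor_product_commutator:
  assumes X: "X \<in> Der K R" and Y: "Y \<in> Der K R"
    and \<alpha>: "\<alpha> \<in> carrier \<Omega>" and \<beta>: "\<beta> \<in> carrier \<Omega>"
    and symmetric: "\<alpha> Y \<otimes> \<beta> (der_bracket R X Y) = \<beta> Y \<otimes> \<alpha> (der_bracket R X Y)"
  defines "D \<equiv> lie_derivative K R X"
  shows "(\<alpha> Y \<odot>\<^bsub>\<Omega>\<^esub> D \<beta> \<ominus>\<^bsub>\<Omega>\<^esub> \<beta> Y \<odot>\<^bsub>\<Omega>\<^esub> D \<alpha>) Y \<odot>\<^bsub>T\<^esub> X
    = der_bracket R (\<alpha> Y \<odot>\<^bsub>T\<^esub> X) (\<beta> Y \<odot>\<^bsub>T\<^esub> X)" (is "?s \<odot>\<^bsub>T\<^esub> X = ?r")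
proof (rule Der_eqI)
  have D [simp]: "D \<delta> \<in> carrier \<Omega>" if "\<delta> \<in> carrier \<Omega>" for \<delta>
    using X that by (simp add: D_def)
  show "?s \<odot>\<^bsub>T\<^esub> X \<in> Der K R" "?r \<in> Der K R"
    using assms(1-4) by simp_all
  define a b where "a = \<alpha> Y" and "b = \<beta> Y"
  define a' b' where "a' = \<alpha> (der_bracket R X Y)" and "b' = \<beta> (der_bracket R X Y)"
  have cl: "a \<in> carrier R" "b \<in> carrier R" "a' \<in> carrier R" "b' \<in> carrier R"
      "X a \<in> carrier R" "X b \<in> carrier R"
    using assms(1-4) by (simp_all add: a_def b_def a'_def b'_def)
  have "?s = a \<otimes> (X b \<ominus> b') \<ominus> b \<otimes> (X a \<ominus> a')"
    using assms(1-4) Y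
    by (simp add: a_def b_def a'_def b'_def) (simp add: D_def lie_derivative_apply)
  also have "\<dots> = (a \<otimes> X b \<ominus> b \<otimes> X a) \<ominus> (a \<otimes> b' \<ominus> b \<otimes> a')"
    using cl by algebra
  also have "a \<otimes> b' \<ominus> b \<otimes> a' = \<zero>"
    using symmetric cl by (simp add: a_def b_def a'_def b'_def a_minus_def M.r_neg)
  finally have s: "?s = a \<otimes> X b \<ominus> b \<otimes> X a"
    using cl by (simp add: a_minus_def)
  fix r assume r: "r \<in> carrier R"
  have cl': "X r \<in> carrier R" "X (X r) \<in> carrier R"
    using X r by simp_all
  have "(?s \<odot>\<^bsub>T\<^esub> X) r = (a \<otimes> X b \<ominus> b \<otimes> X a) \<otimes> X r"
    using r by (simp add: s)
  also have "\<dots> = a \<otimes> (X b \<otimes> X r \<oplus> b \<otimes> X (X r)) \<ominus> b \<otimes> (X a \<otimes> X r \<oplus> a \<otimes> X (X r))"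
    using cl cl' by algebra
  also have "\<dots> = ?r r"
    using r cl cl' by (simp add: Der_mult[OF X] flip: a_def b_def)
  finally show "(?s \<odot>\<^bsub>T\<^esub> X) r = ?r r" .
qed

theorem (in derivation_calculus) pre_lie_rinehart_one_forms:
  fixes X Y
  assumes X: "X \<in> Der K R" and Y: "Y \<in> Der K R"
    and symmetric: "\<And>\<alpha> \<beta>. \<alpha> \<in> carrier \<Omega> \<Longrightarrow> \<beta> \<in> carrier \<Omega> \<Longrightarrow>
      \<alpha> Y \<otimes> \<beta> (der_bracket R X Y) = \<beta> Y \<otimes> \<alpha> (der_bracket R X Y)"
  defines "\<rho> \<equiv> \<lambda>\<alpha>\<in>carrier \<Omega>. \<alpha> Y \<odot>\<^bsub>T\<^esub> X"
    and "nabla \<equiv> \<lambda>\<alpha>\<in>carrier \<Omega>. \<lambda>\<beta>\<in>carrier \<Omega>. \<alpha> Y \<odot>\<^bsub>\<Omega>\<^esub> lie_derivative K R X \<beta>"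
  shows "pre_lie_rinehart_algebra K R \<Omega> \<rho> nabla"
proof -
  let ?D = "lie_derivative K R X"
  have \<rho> [simp]: "\<rho> \<alpha> = \<alpha> Y \<odot>\<^bsub>T\<^esub> X" if "\<alpha> \<in> carrier \<Omega>" for \<alpha>
    using that by (simp add: \<rho>_def)
  have nabla [simp]: "nabla \<alpha> \<beta> = \<alpha> Y \<odot>\<^bsub>\<Omega>\<^esub> ?D \<beta>" if "\<alpha> \<in> carrier \<Omega>" "\<beta> \<in> carrier \<Omega>" for \<alpha> \<beta>
    using that by (simp add: nabla_def)
  \<comment> \<open>Linearity over \<open>K\<close> is the Leibniz rule for constants, on which \<open>X\<close> vanishes.\<close>
  have nabla_scalars: "nabla \<alpha> \<in> linear_maps K (restrict_scalars R \<Omega>) (restrict_scalars R \<Omega>)"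
    if \<alpha>: "\<alpha> \<in> carrier \<Omega>" for \<alpha>
  proof -
    have "nabla \<alpha> \<in> carrier \<Omega> \<rightarrow>\<^sub>E carrier \<Omega>"
      using X Y \<alpha> by (auto simp: nabla_def)
    moreover have "nabla \<alpha> (\<beta> \<oplus>\<^bsub>\<Omega>\<^esub> \<gamma>) = nabla \<alpha> \<beta> \<oplus>\<^bsub>\<Omega>\<^esub> nabla \<alpha> \<gamma>"
      if "\<beta> \<in> carrier \<Omega>" "\<gamma> \<in> carrier \<Omega>" for \<beta> \<gamma>
      using X Y \<alpha> that by (simp add: lie_derivative_add \<Omega>.smult_r_distr)
    moreover have "nabla \<alpha> ((c \<odot> \<one>) \<odot>\<^bsub>\<Omega>\<^esub> \<beta>) = (c \<odot> \<one>) \<odot>\<^bsub>\<Omega>\<^esub> nabla \<alpha> \<beta>"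
      if "c \<in> carrier K" "\<beta> \<in> carrier \<Omega>" for c \<beta>
      using X Y \<alpha> that
      by (simp add: lie_derivative_smult Der_constant m_comm flip: \<Omega>.smult_assoc1)
    ultimately show ?thesis by (simp add: linear_maps_def)
  qed
  have nabla_leibniz: "nabla \<alpha> (r \<odot>\<^bsub>\<Omega>\<^esub> \<beta>) = r \<odot>\<^bsub>\<Omega>\<^esub> nabla \<alpha> \<beta> \<oplus>\<^bsub>\<Omega>\<^esub> \<rho> \<alpha> r \<odot>\<^bsub>\<Omega>\<^esub> \<beta>"
    if "\<alpha> \<in> carrier \<Omega>" "\<beta> \<in> carrier \<Omega>" "r \<in> carrier R" for \<alpha> \<beta> r
    using X Y that
    by (simp add: lie_derivative_smult \<Omega>.smult_r_distr m_comm flip: \<Omega>.smult_assoc1)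
  have \<rho>_add: "\<rho> (\<alpha> \<oplus>\<^bsub>\<Omega>\<^esub> \<beta>) = \<rho> \<alpha> \<oplus>\<^bsub>T\<^esub> \<rho> \<beta>" if "\<alpha> \<in> carrier \<Omega>" "\<beta> \<in> carrier \<Omega>" for \<alpha> \<beta>
    using X Y that module.smult_l_distr[OF module_T] by simp
  have \<rho>_smult: "\<rho> (r \<odot>\<^bsub>\<Omega>\<^esub> \<alpha>) = r \<odot>\<^bsub>T\<^esub> \<rho> \<alpha>" if "r \<in> carrier R" "\<alpha> \<in> carrier \<Omega>" for \<alpha> r
    using X Y that module.smult_assoc1[OF module_T] by simp
  have nabla_add: "nabla (\<alpha> \<oplus>\<^bsub>\<Omega>\<^esub> \<beta>) = (\<lambda>\<gamma>\<in>carrier \<Omega>. nabla \<alpha> \<gamma> \<oplus>\<^bsub>\<Omega>\<^esub> nabla \<beta> \<gamma>)"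
    if "\<alpha> \<in> carrier \<Omega>" "\<beta> \<in> carrier \<Omega>" for \<alpha> \<beta>
  proof -
    have "nabla (\<alpha> \<oplus>\<^bsub>\<Omega>\<^esub> \<beta>) = (\<lambda>\<gamma>\<in>carrier \<Omega>. (\<alpha> Y \<oplus> \<beta> Y) \<odot>\<^bsub>\<Omega>\<^esub> ?D \<gamma>)"
      using Y that by (simp add: nabla_def)
    also have "\<dots> = (\<lambda>\<gamma>\<in>carrier \<Omega>. nabla \<alpha> \<gamma> \<oplus>\<^bsub>\<Omega>\<^esub> nabla \<beta> \<gamma>)"
      using X Y that by (intro restrict_ext) (simp add: \<Omega>.smult_l_distr)
    finally show ?thesis .
  qed
  have nabla_smult: "nabla (r \<odot>\<^bsub>\<Omega>\<^esub> \<alpha>) = (\<lambda>\<gamma>\<in>carrier \<Omega>. r \<odot>\<^bsub>\<Omega>\<^esub> nabla \<alpha> \<gamma>)"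
    if "r \<in> carrier R" "\<alpha> \<in> carrier \<Omega>" for r \<alpha>
  proof -
    have "nabla (r \<odot>\<^bsub>\<Omega>\<^esub> \<alpha>) = (\<lambda>\<gamma>\<in>carrier \<Omega>. (r \<otimes> \<alpha> Y) \<odot>\<^bsub>\<Omega>\<^esub> ?D \<gamma>)"
      using Y that by (simp add: nabla_def)
    also have "\<dots> = (\<lambda>\<gamma>\<in>carrier \<Omega>. r \<odot>\<^bsub>\<Omega>\<^esub> nabla \<alpha> \<gamma>)"
      using X Y that by (intro restrict_ext) (simp add: \<Omega>.smult_assoc1)
    finally show ?thesis .
  qed
  have \<rho>_closed: "\<rho> \<alpha> \<in> Der K R" if "\<alpha> \<in> carrier \<Omega>" for \<alpha>
    using X Y that by simp
  show ?thesis
  proof (intro pre_lie_rinehart_algebra.intro pre_lie_rinehart_algebra_axioms.intro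
      A.algebra_axioms module_one_forms)
    \<comment> \<open>The evaluation rules for \<open>\<rho>\<close> and \<open>nabla\<close> are withdrawn so that the rules for sums and
      multiples apply to them unexpanded.\<close>
    show "\<rho> \<in> linear_maps R \<Omega> T"
      using \<rho>_closed \<rho>_add \<rho>_smult
      by (auto simp: linear_maps_def simp del: \<rho>) (auto simp: \<rho>_def)
    show "(\<lambda>\<alpha>\<in>carrier \<Omega>. (nabla \<alpha>, \<rho> \<alpha>)) \<in> linear_maps R \<Omega> (CDO K R \<Omega>)"
      using nabla_scalars \<rho>_closed nabla_leibniz
      by (auto simp: linear_maps_def[of R] CDO_def Let_def pointwise_module_ops
          nabla_add nabla_smult \<rho>_add \<rho>_smult simp del: \<rho> nabla)
    show "associator \<Omega> nabla \<alpha> \<beta> \<gamma> = associator \<Omega> nabla \<beta> \<alpha> \<gamma>"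
      if "\<alpha> \<in> carrier \<Omega>" "\<beta> \<in> carrier \<Omega>" "\<gamma> \<in> carrier \<Omega>" for \<alpha> \<beta> \<gamma>
    proof -
      have "associator \<Omega> nabla \<alpha> \<beta> \<gamma> = (\<alpha> Y \<otimes> \<beta> Y) \<odot>\<^bsub>\<Omega>\<^esub> ?D (?D \<gamma>)
          \<oplus>\<^bsub>\<Omega>\<^esub> (\<alpha> Y \<otimes> \<beta> (der_bracket R X Y)) \<odot>\<^bsub>\<Omega>\<^esub> ?D \<gamma>"
        if "\<alpha> \<in> carrier \<Omega>" "\<beta> \<in> carrier \<Omega>" "\<gamma> \<in> carrier \<Omega>" for \<alpha> \<beta> \<gamma>
        using X Y that product_associator[OF X Y that]
        by (simp add: associator_def del: one_forms_apply)
      then show ?thesis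
        using that symmetric[of \<alpha> \<beta>] Y by (simp add: m_comm)
    qed
    show "\<rho> (commutator \<Omega> nabla \<alpha> \<beta>) = der_bracket R (\<rho> \<alpha>) (\<rho> \<beta>)"
      if "\<alpha> \<in> carrier \<Omega>" "\<beta> \<in> carrier \<Omega>" for \<alpha> \<beta>
      using X Y that anchor_product_commutator[OF X Y that symmetric]
      by (simp add: commutator_def del: one_forms_apply one_forms_minus_apply)
  qed
qed

theorem corollary4p12:
  fixes K :: "('k, 'x) ring_scheme"
    and R :: "('k, 'r, 'y) module_scheme"
    and X Y :: "'r \<Rightarrow> 'r"
  assumes "field K"
    and "\<And>n :: nat. n > 0 \<Longrightarrow> [n] \<cdot>\<^bsub>K\<^esub> \<one>\<^bsub>K\<^esub> \<noteq> \<zero>\<^bsub>K\<^esub>"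
    and "algebra K R"
    and "X \<in> Der K R" and "Y \<in> Der K R"
    and "\<And>\<alpha>\<^sub>1 \<alpha>\<^sub>2. \<lbrakk>\<alpha>\<^sub>1 \<in> carrier (one_forms K R); \<alpha>\<^sub>2 \<in> carrier (one_forms K R)\<rbrakk> \<Longrightarrow>
      \<langle>\<alpha>\<^sub>1, Y\<rangle> \<otimes>\<^bsub>R\<^esub> \<langle>\<alpha>\<^sub>2, der_bracket R X Y\<rangle> = \<langle>\<alpha>\<^sub>2, Y\<rangle> \<otimes>\<^bsub>R\<^esub> \<langle>\<alpha>\<^sub>1, der_bracket R X Y\<rangle>"
  shows
    "let \<Omega> = one_forms K R;
         \<rho> = (\<lambda>\<alpha>\<in>carrier \<Omega>. \<langle>\<alpha>, Y\<rangle> \<odot>\<^bsub>der_module K R\<^esub> X);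
         nabla = (\<lambda>\<alpha>\<^sub>1\<in>carrier \<Omega>. \<lambda>\<alpha>\<^sub>2\<in>carrier \<Omega>. \<langle>\<alpha>\<^sub>1, Y\<rangle> \<odot>\<^bsub>\<Omega>\<^esub> lie_derivative K R X \<alpha>\<^sub>2)
     in pre_lie_rinehart_algebra K R \<Omega> \<rho> nabla \<and>
        lie_rinehart_algebra K R \<Omega> (commutator \<Omega> nabla) \<rho> \<and>
        (\<forall>\<alpha>\<^sub>1\<in>carrier \<Omega>. \<forall>\<alpha>\<^sub>2\<in>carrier \<Omega>.
           commutator \<Omega> nabla \<alpha>\<^sub>1 \<alpha>\<^sub>2 =
             \<langle>\<alpha>\<^sub>1, Y\<rangle> \<odot>\<^bsub>\<Omega>\<^esub> lie_derivative K R X \<alpha>\<^sub>2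
             \<ominus>\<^bsub>\<Omega>\<^esub> \<langle>\<alpha>\<^sub>2, Y\<rangle> \<odot>\<^bsub>\<Omega>\<^esub> lie_derivative K R X \<alpha>\<^sub>1)"
proof -
  interpret derivation_calculus K R
    by (intro derivation_calculus.intro assms(3))
  define nabla where "nabla = (\<lambda>\<alpha>\<in>carrier \<Omega>. \<lambda>\<beta>\<in>carrier \<Omega>. \<alpha> Y \<odot>\<^bsub>\<Omega>\<^esub> lie_derivative K R X \<beta>)"
  interpret pre_lie_rinehart_algebra K R \<Omega> "\<lambda>\<alpha>\<in>carrier \<Omega>. \<alpha> Y \<odot>\<^bsub>T\<^esub> X" nabla
    unfolding nabla_def
    using assms(4-6) by (intro pre_lie_rinehart_one_forms) (auto simp: pairing_def)
  show ?thesis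
    using pre_lie_rinehart_algebra_axioms lie_rinehart_commutator
    by (simp add: Let_def pairing_def nabla_def commutator_def)
qed

end
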